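(* For $n\ge 0$, $\left|\mathcal{S}^2_n(213)\right|=a_n$, where $a_n$ is the number of lattice paths from $(0,0)$ to $(4n,0)$ using steps $(1,3)$, $(2,2)$ and $(1,-1)$ that stay weakly above the $x$-axis.
   Context: $\mathcal{S}^2_n(P)$ denotes the set of permutations $\pi\in\mathcal{S}_{3n}$ that avoid every pattern in $P$ (classical pattern avoidance) and satisfy $\pi_{3i+1}<\pi_{3i+2}$ and $\pi_{3i+1}<\pi_{3i+3}$ for all $0\le i<n$. *)

theory Defs
  imports
    "HOL-Combinatorics.Multiset_Permutations"
    "HOL-Library.Sublist"
    "HOL-Library.Product_Plus"
begin

text \<open>
  A permutation of \<open>{1..m}\<close>, and likewise a pattern, is its one-line notation
  \<open>[\<pi>\<^sub>1, \<dots>, \<pi>\<^sub>m]\<close>. List positions start at \<open>0\<close>, so \<open>\<pi>\<^sub>k\<close> is \<open>w ! (k - 1)\<close>.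
\<close>

definition order_isomorphic :: "nat list \<Rightarrow> nat list \<Rightarrow> bool" where
  "order_isomorphic v p \<longleftrightarrow>
     length v = length p \<and>
     (\<forall>i < length p. \<forall>j < length p. v ! i < v ! j \<longleftrightarrow> p ! i < p ! j)"

definition contains_pattern :: "nat list \<Rightarrow> nat list \<Rightarrow> bool" where
  "contains_pattern w p \<longleftrightarrow> (\<exists>v. subseq v w \<and> order_isomorphic v p)"

definition avoids :: "nat list \<Rightarrow> nat list set \<Rightarrow> bool" where
  "avoids w P \<longleftrightarrow> (\<forall>p \<in> P. \<not> contains_pattern w p)"

definition S2 :: "nat \<Rightarrow> nat list set \<Rightarrow> nat list set" where
  "S2 n P =
     {w \<in> permutations_of_set {1..3 * n}.
        avoids w P \<and>
        (\<forall>i < n. w ! (3 * i) < w ! (3 * i + 1) \<and> w ! (3 * i) < w ! (3 * i + 2))}"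

text \<open>
  A lattice path starting at the origin is its list of steps, and the sum of the first \<open>k\<close>
  steps is the point reached after them. A path is the union of the segments between
  consecutive such points, so it stays weakly above the \<open>x\<close>-axis iff these points do.
\<close>

definition lattice_paths :: "(int \<times> int) set \<Rightarrow> int \<times> int \<Rightarrow> (int \<times> int) list set" where
  "lattice_paths A e = {s. set s \<subseteq> A \<and> sum_list s = e}"

definition weakly_above_axis :: "(int \<times> int) list \<Rightarrow> bool" where
  "weakly_above_axis s \<longleftrightarrow> (\<forall>k \<le> length s. snd (sum_list (take k s)) \<ge> 0)"

definition path_count :: "nat \<Rightarrow> nat" where
  "path_count n = card {s \<in> lattice_paths {(1, 3), (2, 2), (1, -1)} (4 * int n, 0). weakly_above_axis s}"

end

theory Submission
  imports Defs "HOL-Computational_Algebra.Formal_Power_Series"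
begin

text \<open>
  A word with minimum \<open>a\<close>, written \<open>L @ a # R\<close>, avoids 213 iff \<open>L\<close> and \<open>R\<close> do and every entry of \<open>L\<close>
  exceeds every entry of \<open>R\<close>. Let \<open>G\<^sub>j\<close> be the generating function of the 213-avoiding words consisting
  of \<open>j\<close> free entries followed by triples that start with their minimum. Splitting at the minimum gives
  \<open>G\<^sub>0 = 1 + X G\<^sub>0 G\<^sub>2\<close>, \<open>G\<^sub>1 = G\<^sub>0 + X G\<^sub>1 G\<^sub>2\<close> and \<open>G\<^sub>2 = G\<^sub>1 + G\<^sub>0 + X G\<^sub>2 G\<^sub>2\<close>, whence \<open>G\<^sub>1 = G\<^sub>0\<^sup>2\<close>,
  \<open>G\<^sub>2 = G\<^sub>0\<^sup>3 + G\<^sub>0\<^sup>2\<close> and \<open>G\<^sub>0 = 1 + X (G\<^sub>0\<^sup>4 + G\<^sub>0\<^sup>3)\<close>. For any such series, the paths from height \<open>h\<close>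
  to the axis with \<open>n\<close> up-steps are counted by the \<open>n\<close>-th coefficient of \<open>G\<^sub>0\<close> to the power \<open>h + 1\<close>.
\<close>

unbundle fps_syntax

section \<open>Permutations avoiding 213\<close>

definition avoids_213 :: "nat list \<Rightarrow> bool" where
  "avoids_213 w \<longleftrightarrow> (\<forall>a b c. subseq [b, a, c] w \<longrightarrow> \<not> (a < b \<and> b < c))"

lemma order_isomorphic_213_iff:
  "order_isomorphic v [2, 1, 3] \<longleftrightarrow> (\<exists>a b c. v = [b, a, c] \<and> a < b \<and> b < c)"
proof
  assume *: "order_isomorphic v [2, 1, 3]"
  then have len: "length v = 3" by (simp add: order_isomorphic_def)
  then obtain b a c where v: "v = [b, a, c]"
    by (auto simp: numeral_3_eq_3 length_Suc_conv)
  from * have "\<And>i j. i < 3 \<Longrightarrow> j < 3 \<Longrightarrow> v ! i < v ! j \<longleftrightarrow> [2, 1, 3::nat] ! i < [2, 1, 3] ! j"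
    by (simp add: order_isomorphic_def)
  from this[of 1 0] this[of 0 2] show "\<exists>a b c. v = [b, a, c] \<and> a < b \<and> b < c"
    by (auto simp: v numeral_2_eq_2)
qed (auto simp: order_isomorphic_def less_Suc_eq numeral_2_eq_2 numeral_3_eq_3)

lemma avoids_213_iff: "avoids w {[2, 1, 3]} \<longleftrightarrow> avoids_213 w"
  unfolding avoids_def contains_pattern_def avoids_213_def ball_simps order_isomorphic_213_iff by auto

lemma avoids_213_subseq: "avoids_213 w \<Longrightarrow> subseq v w \<Longrightarrow> avoids_213 v"
  unfolding avoids_213_def by (meson subseq_order.order_trans)

lemma set_subseq: "subseq xs ys \<Longrightarrow> set xs \<subseteq> set ys"
  by (auto elim: list_emb_set)

lemma subseq_Cons_Cons_iff: "subseq (x # xs) (a # R) \<longleftrightarrow> subseq (x # xs) R \<or> x = a \<and> subseq xs R"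
  by (auto dest: subseq_Cons')

lemma subseq2_append_iff:
  "subseq [x, y] (L @ M) \<longleftrightarrow> subseq [x, y] L \<or> x \<in> set L \<and> y \<in> set M \<or> subseq [x, y] M"
  by (induction L) (auto simp: subseq_Cons_Cons_iff subseq_singleton_left dest: set_subseq)

lemma subseq3_append_iff:
  "subseq [x, y, z] (L @ M) \<longleftrightarrow> subseq [x, y, z] L \<or> subseq [x, y] L \<and> z \<in> set M \<or>
     x \<in> set L \<and> subseq [y, z] M \<or> subseq [x, y, z] M"
  by (induction L) (auto simp: subseq_Cons_Cons_iff subseq2_append_iff subseq_singleton_left dest: subseq_Cons' set_subseq)

text \<open>If x in \<open>L\<close> were smaller than y in \<open>R\<close>, then x,
  \<open>a\<close>, y would form a 213 with \<open>a\<close> as its smallest letter. Conversely, an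
  occurrence meeting both sides of the cut before \<open>a\<close> has its last letter below its
  first, and one beginning at \<open>a\<close> has its smallest letter above
  \<open>a\<close>.\<close>

lemma avoids_213_append_min:
  assumes "\<forall>x \<in> set L \<union> set R. a < x" "set L \<inter> set R = {}"
  shows "avoids_213 (L @ a # R) \<longleftrightarrow> avoids_213 L \<and> avoids_213 R \<and> (\<forall>x \<in> set L. \<forall>y \<in> set R. y < x)"
    (is "?l \<longleftrightarrow> ?r")
proof
  assume l: ?l
  have "y < x" if "x \<in> set L" "y \<in> set R" for x y
  proof -
    have "subseq [x, a, y] (L @ a # R)"
      using that by (simp add: subseq3_append_iff subseq_singleton_left)
    with l have "\<not> x < y" using assms that by (auto simp: avoids_213_def)
    moreover have "x \<noteq> y" using assms that by auto
    ultimately show ?thesis by simp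
  qed
  moreover have "subseq L (L @ a # R)" by (rule prefix_imp_subseq) simp
  moreover have "subseq R (L @ a # R)" by (intro suffix_imp_subseq suffixI[of _ "L @ [a]"]) simp
  ultimately show ?r using l by (blast intro: avoids_213_subseq)
next
  assume r: ?r
  show ?l unfolding avoids_213_def
  proof (intro allI impI notI)
    fix x y z assume "subseq [y, x, z] (L @ a # R)" and less: "x < y \<and> y < z"
    \<comment> \<open>Cutting before \<open>a\<close> gives these cases; when the first letter lies
      in \<open>L\<close> and the last does not, the position of the middle letter is
      irrelevant.\<close>
    then consider "subseq [y, x, z] L" | "y \<in> set L" "z \<in> insert a (set R)"
      | "subseq [y, x, z] R" | "y = a" "x \<in> set R"
      using set_subseq[of "[y, x]" L] set_subseq[of "[x, z]" R] set_subseq[of "[z]" R]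
      unfolding subseq3_append_iff subseq_Cons_Cons_iff[of _ _ a R] list.set insert_subset by blast
    then show False
    proof cases
      case 2
      then have "z < y" using assms(1) r by auto
      with less show ?thesis by simp
    next
      case 4
      then have "y < x" using assms(1) by auto
      with less show ?thesis by simp
    qed (use r less in \<open>unfold avoids_213_def, blast+\<close>)
  qed
qed

section \<open>Splitting a 213-avoider at its minimum\<close>

text \<open>The cut is at \<open>Min A\<close>, or at the right end if \<open>A\<close> is empty.
  Hence the lengths of the two factors of a 213-avoider determine their value sets, and the factors
  can be chosen independently.\<close>

lemma interval_split:
  fixes A B :: "nat set"
  assumes "A \<union> B = {s..<s + m}" "A \<inter> B = {}" "\<forall>x \<in> A. \<forall>y \<in> B. y < x"
  shows "B = {s..<s + card B}" "A = {s + card B..<s + m}"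
proof -
  have fin: "finite A" "finite B" using assms(1) by (metis finite_Un finite_atLeastLessThan)+
  have "\<exists>x \<le> s + m. s \<le> x \<and> B = {s..<x}"
  proof (cases "A = {}")
    case False
    define x where "x = Min A"
    have x: "x \<in> A" "\<And>y. y \<in> A \<Longrightarrow> x \<le> y" using False fin by (auto simp: x_def)
    have "B = {s..<x}"
    proof
      show "B \<subseteq> {s..<x}" using assms x by auto
      show "{s..<x} \<subseteq> B"
      proof
        fix y assume y: "y \<in> {s..<x}"
        then have "y \<notin> A" using x(2)[of y] by auto
        moreover have "x \<in> {s..<s + m}" using x(1) assms(1) by blast
        with y have "y \<in> A \<union> B" unfolding assms(1) by auto
        ultimately show "y \<in> B" by blast
      qed
    qed
    moreover have "x \<in> {s..<s+m}" using x assms(1) by blast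
    ultimately show ?thesis by (intro exI[of _ x]) auto
  qed (use assms in auto)
  then obtain x where x: "x \<le> s + m" "s \<le> x" "B = {s..<x}" by blast
  then show B: "B = {s..<s + card B}" by auto
  have "A = {s..<s + m} - B" using assms by blast
  also have "\<dots> = {s + card B..<s + m}" using x by auto
  finally show "A = {s + card B..<s + m}" .
qed

text \<open>The start \<open>s\<close> is a parameter because the two factors around the minimum use
  intervals starting at different values.\<close>

definition avoiders :: "nat \<Rightarrow> nat \<Rightarrow> nat list set" where
  "avoiders s k = {w \<in> permutations_of_set {s..<s + k}. avoids_213 w}"

lemma finite_avoiders [simp]: "finite (avoiders s k)"
  by (simp add: avoiders_def)

lemma avoidersD:
  assumes "w \<in> avoiders s k"
  shows "set w = {s..<s + k}" "length w = k" "distinct w"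
  using assms by (auto simp: avoiders_def permutations_of_set_def distinct_card[symmetric])

lemma card_avoiders_small:
  assumes "k \<le> 1"
  shows "card (avoiders s k) = 1"
proof -
  have "avoiders s k = {[s..<s + k]}"
    using assms by (cases k) (auto simp: avoiders_def avoids_213_def dest: list_emb_length)
  then show ?thesis by simp
qed

text \<open>The index \<open>k\<close> is the length of the left factor, which takes the
  \<open>k\<close> largest values; the right factor takes those just above the minimum
  \<open>s\<close>.\<close>

lemma avoiders_Suc:
  "avoiders s (Suc m) = (\<lambda>(k, L, R). L @ s # R) `
     (SIGMA k:{..m}. avoiders (s + 1 + m - k) k \<times> avoiders (s + 1) (m - k))"
proof (intro equalityI subsetI)
  fix w assume "w \<in> avoiders s (Suc m)"
  then have w: "set w = {s..<s + Suc m}" "distinct w" "avoids_213 w"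
    by (auto simp: avoiders_def permutations_of_set_def)
  then have "s \<in> set w" by simp
  then obtain L R where LR: "w = L @ s # R" by (meson split_list)
  with w have d: "distinct L" "distinct R" "set L \<inter> set R = {}" "s \<notin> set L" "s \<notin> set R" by auto
  have "set L \<union> set R = set w - {s}" using LR d by auto
  then have U: "set L \<union> set R = {s + 1..<s + 1 + m}" using w by auto
  then have "\<forall>x \<in> set L \<union> set R. s < x" by simp
  from avoids_213_append_min[OF this d(3)] w(3) LR
  have av: "avoids_213 L" "avoids_213 R" "\<forall>x \<in> set L. \<forall>y \<in> set R. y < x" by auto
  note sp = interval_split[OF U d(3) av(3)]
  have "card (set L \<union> set R) = m" using U by simp
  then have len: "length L + length R = m"
    using d by (simp add: card_Un_disjoint distinct_card)
  have cR: "card (set R) = m - length L" using len distinct_card[OF d(2)] by simp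
  have "(length L, L, R) \<in> (SIGMA k:{..m}. avoiders (s + 1 + m - k) k \<times> avoiders (s + 1) (m - k))"
    using len d av sp unfolding cR by (auto simp: avoiders_def permutations_of_set_def)
  with LR show "w \<in> (\<lambda>(k, L, R). L @ s # R) `
     (SIGMA k:{..m}. avoiders (s + 1 + m - k) k \<times> avoiders (s + 1) (m - k))"
    by (intro image_eqI[of _ _ "(length L, L, R)"]) simp_all
next
  fix w assume "w \<in> (\<lambda>(k, L, R). L @ s # R) `
     (SIGMA k:{..m}. avoiders (s + 1 + m - k) k \<times> avoiders (s + 1) (m - k))"
  then obtain k L R where k: "k \<le> m" and L: "L \<in> avoiders (s + 1 + m - k) k"
    and R: "R \<in> avoiders (s + 1) (m - k)" and w: "w = L @ s # R" by auto
  have "avoids_213 w" unfolding w using L R k avoidersD[OF L] avoidersD[OF R]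
    by (subst avoids_213_append_min) (auto simp: avoiders_def)
  then show "w \<in> avoiders s (Suc m)" using w k avoidersD[OF L] avoidersD[OF R]
    by (auto simp: avoiders_def permutations_of_set_def)
qed

text \<open>The splitting is injective because \<open>s\<close> occurs only once in the word, and
  \<open>k\<close> is recovered as the length of \<open>L\<close>. The predicate \<open>Q\<close>
  lets the triple condition be imposed later.\<close>

lemma card_avoiders_Suc:
  "card {w \<in> avoiders s (Suc m). Q w} =
     (\<Sum>k\<le>m. card {(L, R) \<in> avoiders (s + 1 + m - k) k \<times> avoiders (s + 1) (m - k). Q (L @ s # R)})"
proof -
  define T where "T k = {(L, R) \<in> avoiders (s + 1 + m - k) k \<times> avoiders (s + 1) (m - k). Q (L @ s # R)}" for k
  have fin: "finite (T k)" for k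
    unfolding T_def by (rule finite_subset[of _ "avoiders (s + 1 + m - k) k \<times> avoiders (s + 1) (m - k)"]) auto
  have "{w \<in> f ` S. Q w} = f ` {p \<in> S. Q (f p)}" for f :: "nat \<times> nat list \<times> nat list \<Rightarrow> nat list" and S
    by auto
  moreover have "(SIGMA k:{..m}. T k) = {p \<in> (SIGMA k:{..m}. avoiders (s + 1 + m - k) k \<times>
      avoiders (s + 1) (m - k)). Q (case p of (k, L, R) \<Rightarrow> L @ s # R)}"
    by (auto simp: T_def)
  ultimately have "{w \<in> avoiders s (Suc m). Q w} = (\<lambda>(k, L, R). L @ s # R) ` (SIGMA k:{..m}. T k)"
    unfolding avoiders_Suc by simp
  moreover have "inj_on (\<lambda>(k, L, R). L @ s # R) (SIGMA k:{..m}. T k)"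
  proof (rule inj_onI)
    fix p q
    assume pq: "p \<in> (SIGMA k:{..m}. T k)" "q \<in> (SIGMA k:{..m}. T k)"
      "(\<lambda>(k, L, R). L @ s # R) p = (\<lambda>(k, L, R). L @ s # R) q"
    obtain k L R k' L' R' where eq: "p = (k, L, R)" "q = (k', L', R')" by (cases p, cases q)
    with pq have *: "k \<le> m" "(L, R) \<in> T k" "(L', R') \<in> T k'" "L @ s # R = L' @ s # R'" by auto
    then have L: "L \<in> avoiders (s + 1 + m - k) k" and L': "L' \<in> avoiders (s + 1 + m - k') k'"
      and R: "R \<in> avoiders (s + 1) (m - k)" by (auto simp: T_def)
    have "s \<notin> set L" "s \<notin> set R" using avoidersD(1)[OF L] avoidersD(1)[OF R] * by auto
    with *(4) have "L = L' \<and> R = R'" by (simp add: append_Cons_eq_iff)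
    with avoidersD(2)[OF L] avoidersD(2)[OF L'] show "p = q" by (simp add: eq)
  qed
  ultimately show ?thesis using fin by (simp add: card_image T_def)
qed

section \<open>Words whose triples start with their minimum\<close>

fun min_first_triples :: "nat list \<Rightarrow> bool" where
  "min_first_triples [] = True"
| "min_first_triples [a] = False"
| "min_first_triples [a, b] = False"
| "min_first_triples (a # b # c # w) \<longleftrightarrow> a < b \<and> a < c \<and> min_first_triples w"

lemma min_first_triples_iff:
  "length w = 3 * n \<Longrightarrow>
     min_first_triples w \<longleftrightarrow> (\<forall>i<n. w ! (3 * i) < w ! (3 * i + 1) \<and> w ! (3 * i) < w ! (3 * i + 2))"
proof (induction w arbitrary: n rule: min_first_triples.induct)
  case (4 a b c w)
  then obtain k where k: "n = Suc k" "length w = 3 * k" by (cases n) auto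
  show ?case using 4(1)[OF k(2)] by (simp add: k(1) All_less_Suc2)
qed (auto, presburger+)

text \<open>Within its triple the overall minimum must come first. So whole triples precede it, and
  the first two entries of \<open>v\<close> complete its own triple and satisfy their inequalities
  automatically.\<close>

lemma min_first_triples_append_min:
  assumes "\<forall>x \<in> set u \<union> set v. a < x"
  shows "min_first_triples (u @ a # v) \<longleftrightarrow>
    3 dvd length u \<and> 2 \<le> length v \<and> min_first_triples u \<and> min_first_triples (drop 2 v)"
  using assms
proof (induction u rule: min_first_triples.induct)
  case 1
  then show ?case by (cases v rule: min_first_triples.cases) auto
next
  case (2 b)
  then show ?case by (cases v) auto
next
  case (4 b c d w)
  have "3 dvd length (b # c # d # w) \<longleftrightarrow> 3 dvd length w" by simp presburger
  with 4 show ?case by auto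
qed auto

lemma min_first_triples_map:
  "strict_mono f \<Longrightarrow> min_first_triples (map f w) \<longleftrightarrow> min_first_triples w"
  by (induction w rule: min_first_triples.induct) (auto simp: strict_mono_less)

definition triple_avoiders :: "nat \<Rightarrow> nat \<Rightarrow> nat \<Rightarrow> nat list set" where
  "triple_avoiders j s n = {w \<in> avoiders s (j + 3 * n). min_first_triples (drop j w)}"

lemma avoids_213_map:
  assumes "strict_mono f"
  shows "avoids_213 (map f w) \<longleftrightarrow> avoids_213 w"
proof
  assume *: "avoids_213 (map f w)"
  show "avoids_213 w" unfolding avoids_213_def
  proof (intro allI impI)
    fix a b c assume "subseq [b, a, c] w"
    then have "subseq [f b, f a, f c] (map f w)" using subseq_map[of "[b, a, c]" w f] by simp
    with * show "\<not> (a < b \<and> b < c)" using strict_mono_less[OF assms] by (metis avoids_213_def)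
  qed
next
  assume *: "avoids_213 w"
  show "avoids_213 (map f w)" unfolding avoids_213_def
  proof (intro allI impI)
    fix a b c assume "subseq [b, a, c] (map f w)"
    \<comment> \<open>All three letters lie in the range of \<open>f\<close>, so the occurrence
      pulls back along \<open>inv f\<close> with its order intact.\<close>
    then have "subseq (map (inv f) [b, a, c]) (map (inv f) (map f w))"
      by (rule subseq_map)
    moreover have sub: "set [b, a, c] \<subseteq> range f"
      using set_subseq[OF \<open>subseq [b, a, c] (map f w)\<close>] by auto
    moreover have "inj f" using assms by (rule strict_mono_imp_inj_on)
    ultimately have "subseq [inv f b, inv f a, inv f c] w" by simp
    with * have "\<not> (inv f a < inv f b \<and> inv f b < inv f c)" by (auto simp: avoids_213_def)
    then show "\<not> (a < b \<and> b < c)" using strict_mono_less[OF assms] sub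
      by (metis f_inv_into_f insert_subset list.simps(15))
  qed
qed

lemma card_triple_avoiders_shift: "card (triple_avoiders j s n) = card (triple_avoiders j 0 n)"
proof -
  have mono: "strict_mono ((+) s)" by (simp add: strict_mono_def)
  have "{s..<s + (j + 3 * n)} = (+) s ` {0..<0 + (j + 3 * n)}"
    by (simp add: add.commute)
  then have "permutations_of_set {s..<s + (j + 3 * n)} = map ((+) s) ` permutations_of_set {0..<0 + (j + 3 * n)}"
    using permutations_of_set_image_inj[of "(+) s" "{0..<0 + (j + 3 * n)}"] by simp
  then have "triple_avoiders j s n = map ((+) s) ` triple_avoiders j 0 n"
    unfolding triple_avoiders_def avoiders_def
    by (auto simp: avoids_213_map[OF mono] min_first_triples_map[OF mono] drop_map)
  then show ?thesis by (simp add: card_image inj_on_def)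
qed

text \<open>
  The minimum of such a word is one of the \<open>j\<close> free entries or starts a triple; in the second case the
  rest of its triple becomes the two free entries of the right-hand factor.
\<close>

lemma card_triple_avoiders_rec:
  assumes "j \<le> 2" "0 < j + n"
  shows "card (triple_avoiders j 0 n) = (\<Sum>k<j. card (triple_avoiders (j - 1 - k) 0 n)) +
    (\<Sum>i<n. card (triple_avoiders j 0 i) * card (triple_avoiders 2 0 (n - 1 - i)))"
proof -
  obtain m where m: "j + 3 * n = Suc m" using assms by (cases "j + 3 * n") auto
  define T where "T k = {(L, R) \<in> avoiders (0 + 1 + m - k) k \<times> avoiders (0 + 1) (m - k).
     min_first_triples (drop j (L @ 0 # R))}" for k
  have len: "length L = k" "length R = m - k" "\<forall>x \<in> set L \<union> set R. 0 < x"
    if "k \<le> m" "L \<in> avoiders (0 + 1 + m - k) k" "R \<in> avoiders (0 + 1) (m - k)" for k L R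
    using avoidersD[OF that(2)] avoidersD[OF that(3)] that(1) by auto
  \<comment> \<open>The minimum is a free entry here: all triples and the other
    \<open>j - 1 - k\<close> free entries lie in \<open>R\<close>. Since \<open>j \<le> 2\<close>,
    at most one entry precedes it, so \<open>L\<close> is unique.\<close>
  have low: "card (T k) = card (triple_avoiders (j - 1 - k) 0 n)" if "k < j" for k
  proof -
    have km: "k \<le> m" using that m by linarith
    have e: "m - k = j - 1 - k + 3 * n" using m that by linarith
    have "drop j (L @ 0 # R) = drop (j - 1 - k) R" if "length L = k" for L R :: "nat list"
      using that \<open>k < j\<close> by (simp add: drop_Cons')
    then have "T k = avoiders (0 + 1 + m - k) k \<times> triple_avoiders (j - 1 - k) (0 + 1) n"
      unfolding T_def triple_avoiders_def e[symmetric] using len[OF km] by auto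
    moreover have "card (avoiders (0 + 1 + m - k) k) = 1"
      using that assms by (intro card_avoiders_small) simp
    ultimately show ?thesis
      by (simp only: card_cartesian_product card_triple_avoiders_shift[of _ "0 + 1"] mult_1)
  qed
  have high: "min_first_triples (drop j (L @ 0 # R)) \<longleftrightarrow>
     3 dvd k - j \<and> 2 \<le> m - k \<and> min_first_triples (drop j L) \<and> min_first_triples (drop 2 R)"
    if "j \<le> k" "k \<le> m" "L \<in> avoiders (0 + 1 + m - k) k" "R \<in> avoiders (0 + 1) (m - k)" for k L R
    using len[OF that(2-4)] that(1) min_first_triples_append_min[of "drop j L" R 0]
    by (auto dest: in_set_dropD)
  \<comment> \<open>The minimum starts the triple with index \<open>i\<close>: \<open>L\<close>
    keeps the free entries and \<open>i\<close> triples, while \<open>R\<close> begins with the two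
    leftover entries, followed by \<open>n - 1 - i\<close> triples.\<close>
  have trip: "card (T (j + 3 * i)) = card (triple_avoiders j 0 i) * card (triple_avoiders 2 0 (n - 1 - i))"
    if "i < n" for i
  proof -
    define k where "k = j + 3 * i"
    have k: "j \<le> k" "k \<le> m" "3 dvd k - j" "2 \<le> m - k" "m - k = 2 + 3 * (n - 1 - i)"
      using m that by (auto simp: k_def)
    have "T k = triple_avoiders j (0 + 1 + m - k) i \<times> triple_avoiders 2 (0 + 1) (n - 1 - i)"
      unfolding T_def triple_avoiders_def k(5)[symmetric] k_def[symmetric]
      using high[OF k(1,2)] k(3,4) by auto
    then show ?thesis
      by (simp only: card_cartesian_product card_triple_avoiders_shift[of _ "0 + 1"]
        card_triple_avoiders_shift[of _ "0 + 1 + m - k"] flip: k_def)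
  qed
  have zero: "card (T k) = 0" if k: "k \<le> m" "\<not> k < j" "k \<notin> (\<lambda>i. j + 3 * i) ` {..<n}" for k
  proof -
    have "\<not> (3 dvd k - j \<and> 2 \<le> m - k)"
    proof
      assume "3 dvd k - j \<and> 2 \<le> m - k"
      then obtain i where "k - j = 3 * i" "2 \<le> m - k" by (auto simp: dvd_def)
      with k m have "k = j + 3 * i" "i < n" by auto
      with k(3) show False by auto
    qed
    with high[of k] k(1,2) have "T k = {}" unfolding T_def by (auto simp: not_less)
    then show ?thesis by simp
  qed
  have "card (triple_avoiders j 0 n) = (\<Sum>k\<le>m. card (T k))"
    unfolding triple_avoiders_def m T_def by (rule card_avoiders_Suc)
  also have "\<dots> = (\<Sum>k\<in>{..<j} \<union> (\<lambda>i. j + 3 * i) ` {..<n}. card (T k))"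
    by (rule sum.mono_neutral_right) (use m zero in auto)
  also have "\<dots> = (\<Sum>k<j. card (T k)) + (\<Sum>k\<in>(\<lambda>i. j + 3 * i) ` {..<n}. card (T k))"
    by (rule sum.union_disjoint) auto
  also have "(\<Sum>k\<in>(\<lambda>i. j + 3 * i) ` {..<n}. card (T k)) = (\<Sum>i<n. card (T (j + 3 * i)))"
    by (subst sum.reindex) (auto simp: inj_on_def)
  finally show ?thesis using low trip by simp
qed

section \<open>Generating functions of the triple words\<close>

definition triple_avoiders_fps :: "nat \<Rightarrow> int fps" where
  "triple_avoiders_fps j = Abs_fps (\<lambda>n. int (card (triple_avoiders j 0 n)))"

lemma triple_avoiders_0_0: "card (triple_avoiders 0 0 0) = 1"
proof -
  have "triple_avoiders 0 0 0 = avoiders 0 0" by (auto simp: triple_avoiders_def dest: avoidersD)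
  then show ?thesis by (simp add: card_avoiders_small)
qed

text \<open>The summand 1 for \<open>j = 0\<close> is the empty word, which has no minimum to split
  at. The factor \<open>fps_X\<close> accounts for the triple that is broken up when the minimum
  starts it.\<close>

lemma triple_avoiders_fps_rec:
  assumes "j \<le> 2"
  shows "triple_avoiders_fps j = (if j = 0 then 1 else 0) + (\<Sum>k<j. triple_avoiders_fps (j - 1 - k)) +
    fps_X * (triple_avoiders_fps j * triple_avoiders_fps 2)"
proof (rule fps_ext)
  fix n
  show "triple_avoiders_fps j $ n = ((if j = 0 then 1 else 0) +
    (\<Sum>k<j. triple_avoiders_fps (j - 1 - k)) + fps_X * (triple_avoiders_fps j * triple_avoiders_fps 2)) $ n"
  proof (cases "j + n = 0")
    case True
    then show ?thesis using triple_avoiders_0_0 by (simp add: triple_avoiders_fps_def)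
  next
    case False
    have "(\<Sum>i<n. int (card (triple_avoiders j 0 i)) * int (card (triple_avoiders 2 0 (n - 1 - i)))) =
      (fps_X * (triple_avoiders_fps j * triple_avoiders_fps 2)) $ n"
      by (cases n) (simp_all add: fps_mult_nth[of "Abs_fps _"] triple_avoiders_fps_def lessThan_Suc_atMost atMost_atLeast0)
    then show ?thesis using card_triple_avoiders_rec[OF assms, of n] False
      by (cases "j = 0") (auto simp: fps_sum_nth triple_avoiders_fps_def fps_one_nth)
  qed
qed

lemma triple_avoiders_fps_eq:
  fixes A :: "int fps"
  defines "A \<equiv> triple_avoiders_fps 0"
  shows "A = 1 + fps_X * (A ^ 4 + A ^ 3)"
proof -
  define B C where "B = triple_avoiders_fps 1" and "C = triple_avoiders_fps 2"
  have A: "A = 1 + fps_X * (A * C)" and B: "B = A + fps_X * (B * C)"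
    and C: "C = B + A + fps_X * (C * C)"
    using triple_avoiders_fps_rec[of 0] triple_avoiders_fps_rec[of 1] triple_avoiders_fps_rec[of 2]
    by (simp_all add: A_def B_def C_def numeral_2_eq_2 lessThan_Suc add_ac)
  \<comment> \<open>All three equations contain the factor \<open>1 - fps_X * C\<close>; as
    \<open>A\<close> is its inverse, multiplying by \<open>A\<close> solves them for
    \<open>B\<close> and then \<open>C\<close>.\<close>
  have inv: "(1 - fps_X * C) * A = 1" using A by (simp add: algebra_simps)
  have "B = (B - fps_X * (B * C)) * A" using inv by algebra
  then have B2: "B = A ^ 2" using B by algebra
  have "C = (C - fps_X * (C * C)) * A" using inv by algebra
  also have "C - fps_X * (C * C) = B + A" using C by algebra
  finally have "C = A ^ 3 + A ^ 2" using B2 by algebra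
  with A show ?thesis by algebra
qed

lemma S2_213_eq: "S2 n {[2, 1, 3]} = triple_avoiders 0 1 n"
proof -
  have "min_first_triples w \<longleftrightarrow> (\<forall>i<n. w ! (3 * i) < w ! (3 * i + 1) \<and> w ! (3 * i) < w ! (3 * i + 2))"
    if "w \<in> avoiders 1 (3 * n)" for w
    by (rule min_first_triples_iff) (use avoidersD[OF that] in simp)
  moreover have "{1..3 * n} = {1..<1 + 3 * n}" by auto
  ultimately show ?thesis
    unfolding S2_def triple_avoiders_def avoiders_def avoids_213_iff by auto
qed

section \<open>Lattice paths\<close>

text \<open>These are paths from height \<open>h\<close> down to the axis, translated to start at
  the origin. Both up-steps raise the sum of the coordinates by 4 and the down-step preserves it, so
  this end point forces exactly \<open>n\<close> up-steps.\<close>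

definition paths_from :: "nat \<Rightarrow> nat \<Rightarrow> (int \<times> int) list set" where
  "paths_from n h = {s \<in> lattice_paths {(1, 3), (2, 2), (1, -1)} (4 * int n + int h, - int h).
     \<forall>k \<le> length s. 0 \<le> int h + snd (sum_list (take k s))}"

lemma all_le_Suc_iff: "(\<forall>k \<le> Suc n. P k) \<longleftrightarrow> P 0 \<and> (\<forall>k \<le> n. P (Suc k))"
  by (metis Suc_le_mono le0 not0_implies_Suc)

lemma Cons_mem_paths_from_iff:
  "x # t \<in> paths_from n h \<longleftrightarrow> x \<in> {(1, 3), (2, 2), (1, -1)} \<and>
     t \<in> lattice_paths {(1, 3), (2, 2), (1, -1)} (4 * int n + int h - fst x, - int h - snd x) \<and>
     (\<forall>k \<le> length t. 0 \<le> int h + snd x + snd (sum_list (take k t)))"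
  by (cases x) (auto simp: paths_from_def lattice_paths_def all_le_Suc_iff add.assoc prod_eq_iff)

text \<open>No step lowers the coordinate sum. This rules out an up-step when \<open>n = 0\<close>,
  since the remaining steps would have to sum to -4.\<close>

lemma lattice_paths_fst_snd:
  "t \<in> lattice_paths {(1, 3), (2, 2), (1, -1)} (a, b) \<Longrightarrow> 0 \<le> a + b"
proof (induction t arbitrary: a b)
  case (Cons x t)
  then have "t \<in> lattice_paths {(1, 3), (2, 2), (1, -1)} (a - fst x, b - snd x)"
    "x \<in> {(1, 3), (2, 2), (1, -1)}"
    by (auto simp: lattice_paths_def prod_eq_iff)
  with Cons.IH[of "a - fst x" "b - snd x"] show ?case by auto
qed (auto simp: lattice_paths_def zero_prod_def)

lemma Nil_mem_paths_from: "[] \<in> paths_from n h \<longleftrightarrow> n = 0 \<and> h = 0"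
  by (auto simp: paths_from_def lattice_paths_def zero_prod_def)

lemma down_mem_paths_from: "(1, -1) # t \<in> paths_from n h \<longleftrightarrow> 0 < h \<and> t \<in> paths_from n (h - 1)"
proof (cases h)
  case 0
  then show ?thesis by (auto simp: Cons_mem_paths_from_iff intro!: exI[of _ 0])
qed (auto simp: Cons_mem_paths_from_iff, auto simp: paths_from_def algebra_simps)

lemma up3_mem_paths_from: "(1, 3) # t \<in> paths_from n h \<longleftrightarrow> 0 < n \<and> t \<in> paths_from (n - 1) (h + 3)"
proof (cases n)
  case 0
  then show ?thesis by (auto simp: Cons_mem_paths_from_iff dest: lattice_paths_fst_snd)
qed (auto simp: Cons_mem_paths_from_iff, auto simp: paths_from_def algebra_simps)

lemma up2_mem_paths_from: "(2, 2) # t \<in> paths_from n h \<longleftrightarrow> 0 < n \<and> t \<in> paths_from (n - 1) (h + 2)"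
proof (cases n)
  case 0
  then show ?thesis by (auto simp: Cons_mem_paths_from_iff dest: lattice_paths_fst_snd)
qed (auto simp: Cons_mem_paths_from_iff, auto simp: paths_from_def algebra_simps)

lemma paths_from_eq:
  "paths_from n h = (if n = 0 \<and> h = 0 then {[]} else {}) \<union>
     (if h = 0 then {} else (#) (1, -1) ` paths_from n (h - 1)) \<union>
     (if n = 0 then {} else (#) (1, 3) ` paths_from (n - 1) (h + 3)) \<union>
     (if n = 0 then {} else (#) (2, 2) ` paths_from (n - 1) (h + 2))" (is "_ = ?R")
proof (rule set_eqI)
  fix s show "s \<in> paths_from n h \<longleftrightarrow> s \<in> ?R"
  proof (cases s)
    case Nil
    then show ?thesis by (auto simp: Nil_mem_paths_from)
  next
    case (Cons x t)
    have "x = (1, 3) \<or> x = (2, 2) \<or> x = (1, -1)" if "s \<in> paths_from n h"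
      using that by (auto simp: Cons Cons_mem_paths_from_iff)
    then show ?thesis
      using down_mem_paths_from[of t n h] up3_mem_paths_from[of t n h] up2_mem_paths_from[of t n h]
      unfolding Cons by auto
  qed
qed

text \<open>
  Removing the first step matches \<open>A ^ (h + 1) = A ^ h + X * (A ^ (h + 4) + A ^ (h + 3))\<close>,
  whose solution is unique once the constant term is known; no first-return decomposition is needed.
\<close>

lemma card_paths_from:
  fixes A :: "int fps"
  assumes A: "A = 1 + fps_X * (A ^ 4 + A ^ 3)"
  shows "finite (paths_from n h) \<and> int (card (paths_from n h)) = (A ^ (h + 1)) $ n"
\<comment> \<open>An up-step lowers \<open>n\<close> but raises \<open>h\<close>, and a down-step
  lowers \<open>h\<close> at the same \<open>n\<close>. Hence the outer induction on
  \<open>n\<close> for all \<open>h\<close>, with an inner one on \<open>h\<close>.\<close>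
proof (induction n arbitrary: h)
  case 0
  have A0: "A $ 0 = 1" by (subst A) simp
  show ?case
  proof (induction h)
    case 0
    show ?case by (subst (1 2) paths_from_eq) (simp add: A0)
  next
    case (Suc h)
    have "paths_from 0 (Suc h) = (#) (1, -1) ` paths_from 0 h" by (subst paths_from_eq) simp
    with Suc show ?case by (simp add: card_image A0)
  qed
next
  case (Suc n)
  note IHn = Suc.IH
  have up: "int (card ((#) (1, 3) ` paths_from n (h + 3) \<union> (#) (2, 2) ` paths_from n (h + 2))) =
      (A ^ (h + 4)) $ n + (A ^ (h + 3)) $ n" for h
  proof -
    have "h + 3 + 1 = h + 4" "h + 2 + 1 = h + 3" by simp_all
    with Suc.IH[of "h + 3"] Suc.IH[of "h + 2"] show ?thesis
      by (subst card_Un_disjoint) (auto simp: card_image add_ac simp del: add_2_eq_Suc')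
  qed
  have pow: "A ^ (h + 1) = A ^ h + fps_X * (A ^ (h + 4) + A ^ (h + 3))" for h
  proof -
    have "A ^ (h + 1) = A ^ h * (1 + fps_X * (A ^ 4 + A ^ 3))" using A by simp
    then show ?thesis by (simp add: algebra_simps power_add)
  qed
  show ?case
  proof (induction h)
    case 0
    have "paths_from (Suc n) 0 = (#) (1, 3) ` paths_from n (0 + 3) \<union> (#) (2, 2) ` paths_from n (0 + 2)"
      by (subst paths_from_eq) simp
    \<comment> \<open>At height 0 there is no down-step; correspondingly \<open>A ^ 0 = 1\<close>
      has zero coefficient at \<open>Suc n\<close>.\<close>
    moreover have "(A ^ (0 + 1)) $ Suc n = (A ^ (0 + 4)) $ n + (A ^ (0 + 3)) $ n"
      by (subst pow) simp
    ultimately show ?case using up[of 0] Suc.IH by simp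
  next
    case (Suc h)
    let ?D = "(#) (1, -1) ` paths_from (Suc n) h"
    let ?U = "(#) (1, 3) ` paths_from n (Suc h + 3) \<union> (#) (2, 2) ` paths_from n (Suc h + 2)"
    have eq: "paths_from (Suc n) (Suc h) = ?D \<union> ?U"
      by (subst paths_from_eq) (simp add: Un_assoc)
    have fin: "finite ?D" "finite ?U" using Suc.IH IHn by auto
    have "card (?D \<union> ?U) = card ?D + card ?U"
      by (rule card_Un_disjoint[OF fin]) auto
    then have "int (card (paths_from (Suc n) (Suc h))) = (A ^ (h + 1)) $ Suc n + ((A ^ (Suc h + 4)) $ n + (A ^ (Suc h + 3)) $ n)"
      using Suc.IH up[of "Suc h"] by (simp add: eq card_image)
    also have "\<dots> = (A ^ (Suc h + 1)) $ Suc n" by (subst pow[of "Suc h"]) simp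
    finally show ?case using fin by (simp add: eq)
  qed
qed

theorem theorem11:
  fixes n :: nat
  shows "card (S2 n {[2, 1, 3]}) = path_count n"
proof -
  have "path_count n = card (paths_from n 0)"
    by (simp add: path_count_def paths_from_def weakly_above_axis_def)
  moreover have "int (card (paths_from n 0)) = int (card (triple_avoiders 0 0 n))"
    using card_paths_from[OF triple_avoiders_fps_eq, of n 0] by (simp add: triple_avoiders_fps_def)
  moreover have "card (S2 n {[2, 1, 3]}) = card (triple_avoiders 0 0 n)"
    by (simp only: S2_213_eq card_triple_avoiders_shift[of _ 1])
  ultimately show ?thesis by simp
qed

end
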